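(* Let $(X,d_X)$ be a compact metric space and let $\mathbb{I}=\{\mathbb{I}_1,\dots,\mathbb{I}_N\}$ be a random iterated function system on $X$ consisting of deterministic IFSs of bi-Lipschitz contractions. Then there exists a residual set $R\subseteq\Omega$ such that for all $\omega\in R$ $$\dim_{\mathrm A}F_\omega\ =\ \sup_{u\in\Omega}\,\dim_{\mathrm A}F_u.$$
   Context: Assouad dimension: for a non-empty subset $F$ of a compact metric space let $N_r(F)$ be the smallest number of sets of diameter at most $r$ needed to cover $F$. Then $\dim_{\mathrm A}F$ is the infimum of all $\alpha \geq 0$ for which there exist $C,\rho>0$ such that for all $0<r<R\leq\rho$, $\sup_{x\in F}N_r(B(x,R)\cap F)\leq C(R/r)^\alpha$. Random iterated function system (RIFS): $\mathbb{I}=\{\mathbb{I}_1,\dots,\mathbb{I}_N\}$, where each $\mathbb{I}_i=\{S_{i,j}\}_{j\in\mathcal{I}_i}$ is a finite non-empty family of contractions $S_{i,j}:X\to X$; here each $S_{i,j}$ is also bi-Lipschitz onto its image. No separation condition is assumed. Let $\Lambda=\{1,\dots,N\}$ and $\Omega=\Lambda^{\mathbb{N}}$, equipped with the complete metric $d(x,y)=2^{-(x\wedge y)}$ for $x\neq y$, where $x\wedge y$ is the length of the longest common initial segment of $x$ and $y$. For $\omega=(\omega_1,\omega_2,\dots)\in\Omega$, $$F_\omega=\bigcap_{k\geq1}\ \bigcup_{i_1\in\mathcal{I}_{\omega_1},\dots,i_k\in\mathcal{I}_{\omega_k}}S_{\omega_1,i_1}\circ\cdots\circ S_{\omega_k,i_k}(X).$$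 A subset of a complete metric space is residual if its complement is meagre (a countable union of nowhere dense sets). *)

theory Defs
  imports "HOL-Analysis.Analysis"
begin

section \<open>Assouad dimension\<close>

text \<open>
  The library's \<^const>\<open>diameter\<close> is unspecified on unbounded sets, so covering sets are required
  to be bounded. The value is infinite if there is no finite cover, which does not happen for
  subsets of a compact set.
\<close>

definition covering_number :: "real \<Rightarrow> 'a::metric_space set \<Rightarrow> enat" where
  "covering_number r E =
     (INF \<U> \<in> {\<U>. finite \<U> \<and> E \<subseteq> \<Union>\<U> \<and> (\<forall>U\<in>\<U>. bounded U \<and> diameter U \<le> r)}. enat (card \<U>))"

text \<open>
  The dimension is extended-real valued: it is infinite if no exponent is admissible.
\<close>

definition assouad_dim :: "'a::metric_space set \<Rightarrow> ereal" where
  "assouad_dim F = Inf {ereal \<alpha> | \<alpha>. 0 \<le> \<alpha> \<and>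
     (\<exists>C>0. \<exists>\<rho>>0. \<forall>r R. 0 < r \<and> r < R \<and> R \<le> \<rho> \<longrightarrow>
        (SUP x\<in>F. ereal_of_enat (covering_number r (ball x R \<inter> F))) \<le> ereal (C * (R / r) powr \<alpha>))}"


section \<open>Random iterated function systems\<close>

definition contraction_on :: "'a::metric_space set \<Rightarrow> ('a \<Rightarrow> 'a) \<Rightarrow> bool" where
  "contraction_on X f \<longleftrightarrow> f ` X \<subseteq> X \<and> (\<exists>c<1. c-lipschitz_on X f)"

definition bilipschitz_on :: "'a::metric_space set \<Rightarrow> ('a \<Rightarrow> 'b::metric_space) \<Rightarrow> bool" where
  "bilipschitz_on X f \<longleftrightarrow> (\<exists>a>0. \<exists>b>0. \<forall>x\<in>X. \<forall>y\<in>X.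
     a * dist x y \<le> dist (f x) (f y) \<and> dist (f x) (f y) \<le> b * dist x y)"

text \<open>
  \<open>I i\<close> is the index set of the \<open>i\<close>-th iterated function system, consisting of the maps \<open>S i j\<close>
  for \<open>j \<in> I i\<close>, where \<open>i\<close> ranges over \<open>{1..N}\<close>.
\<close>

definition bilipschitz_rifs ::
    "'a::metric_space set \<Rightarrow> nat \<Rightarrow> (nat \<Rightarrow> 'j set) \<Rightarrow> (nat \<Rightarrow> 'j \<Rightarrow> 'a \<Rightarrow> 'a) \<Rightarrow> bool" where
  "bilipschitz_rifs X N I S \<longleftrightarrow> (\<forall>i\<in>{1..N}. finite (I i) \<and> I i \<noteq> {} \<and>
     (\<forall>j\<in>I i. contraction_on X (S i j) \<and> bilipschitz_on X (S i j)))"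

text \<open>
  Sequences are indexed from 0, so \<open>\<omega> n\<close> and \<open>i n\<close> stand for the entries
  \<open>\<omega>\<^sub>n\<^sub>+\<^sub>1\<close> and \<open>i\<^sub>n\<^sub>+\<^sub>1\<close>, and the composition of length \<open>k\<close> is
  \<open>S (\<omega> 0) (i 0) \<circ> \<dots> \<circ> S (\<omega> (k - 1)) (i (k - 1))\<close>.
\<close>

primrec word_map ::
    "(nat \<Rightarrow> 'j \<Rightarrow> 'a \<Rightarrow> 'a) \<Rightarrow> (nat \<Rightarrow> nat) \<Rightarrow> (nat \<Rightarrow> 'j) \<Rightarrow> nat \<Rightarrow> 'a \<Rightarrow> 'a" where
  "word_map S \<omega> i 0 = id"
| "word_map S \<omega> i (Suc k) = word_map S \<omega> i k \<circ> S (\<omega> k) (i k)"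

definition attractor ::
    "'a set \<Rightarrow> (nat \<Rightarrow> 'j set) \<Rightarrow> (nat \<Rightarrow> 'j \<Rightarrow> 'a \<Rightarrow> 'a) \<Rightarrow> (nat \<Rightarrow> nat) \<Rightarrow> 'a set" where
  "attractor X I S \<omega> =
     (\<Inter>k\<in>{1..}. \<Union>i\<in>{i. \<forall>n<k. i n \<in> I (\<omega> n)}. word_map S \<omega> i k ` X)"


section \<open>The sequence space\<close>

definition seq_space :: "nat \<Rightarrow> (nat \<Rightarrow> nat) set" where
  "seq_space N = {\<omega>. \<forall>n. \<omega> n \<in> {1..N}}"

definition common_prefix_length :: "(nat \<Rightarrow> nat) \<Rightarrow> (nat \<Rightarrow> nat) \<Rightarrow> nat" where
  "common_prefix_length x y = (GREATEST k. \<forall>n<k. x n = y n)"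

text \<open>
  This metric is used through the set-based locale \<^locale>\<open>Metric_space\<close>, and is not the
  type-class metric that the library puts on functions with countable domain.
\<close>

definition seq_dist :: "(nat \<Rightarrow> nat) \<Rightarrow> (nat \<Rightarrow> nat) \<Rightarrow> real" where
  "seq_dist x y = (if x = y then 0 else 2 powr - real (common_prefix_length x y))"

abbreviation seq_topology :: "nat \<Rightarrow> (nat \<Rightarrow> nat) topology" where
  "seq_topology N \<equiv> Metric_space.mtopology (seq_space N) seq_dist"

lemma common_prefix_length_ge_iff:
  assumes "x \<noteq> y"
  shows "k \<le> common_prefix_length x y \<longleftrightarrow> (\<forall>n<k. x n = y n)"
proof -
  obtain m where m: "x m \<noteq> y m" using assms by auto
  have bound: "k \<le> m" if "\<forall>n<k. x n = y n" for k
    using m that by (meson not_le)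
  have "\<forall>n<common_prefix_length x y. x n = y n"
    unfolding common_prefix_length_def
    using GreatestI_nat[of "\<lambda>k. \<forall>n<k. x n = y n" 0 m] bound by blast
  moreover have "k \<le> common_prefix_length x y" if "\<forall>n<k. x n = y n"
    unfolding common_prefix_length_def
    using Greatest_le_nat[of "\<lambda>k. \<forall>n<k. x n = y n" k m] bound that by blast
  ultimately show ?thesis by auto
qed

lemma Metric_space_seq: "Metric_space (seq_space N) seq_dist"
proof
  fix x y z :: "nat \<Rightarrow> nat"
  show "0 \<le> seq_dist x y" and "seq_dist x y = 0 \<longleftrightarrow> x = y"
    by (auto simp: seq_dist_def)
  show "seq_dist x y = seq_dist y x"
    by (auto simp: seq_dist_def common_prefix_length_def eq_commute)
  show "seq_dist x z \<le> seq_dist x y + seq_dist y z"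
  proof (cases "x = y \<or> y = z \<or> x = z")
    case True
    then show ?thesis by (auto simp: seq_dist_def)
  next
    case False
    let ?m = "min (common_prefix_length x y) (common_prefix_length y z)"
    have "\<forall>n<?m. x n = z n"
      using False common_prefix_length_ge_iff[of x y ?m] common_prefix_length_ge_iff[of y z ?m]
      by auto
    then have "?m \<le> common_prefix_length x z"
      using False common_prefix_length_ge_iff by blast
    then have "2 powr - real (common_prefix_length x z) \<le> 2 powr - real ?m"
      by simp
    also have "\<dots> \<le> 2 powr - real (common_prefix_length x y) + 2 powr - real (common_prefix_length y z)"
      by (auto simp: min_def)
    finally show ?thesis using False by (simp add: seq_dist_def)
  qed
qed


section \<open>Baire category\<close>

definition nowhere_dense_in :: "'a topology \<Rightarrow> 'a set \<Rightarrow> bool" where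
  "nowhere_dense_in T A \<longleftrightarrow> A \<subseteq> topspace T \<and> T interior_of (T closure_of A) = {}"

definition meagre_in :: "'a topology \<Rightarrow> 'a set \<Rightarrow> bool" where
  "meagre_in T A \<longleftrightarrow> (\<exists>\<A>. countable \<A> \<and> (\<forall>B\<in>\<A>. nowhere_dense_in T B) \<and> A = \<Union>\<A>)"

definition residual_in :: "'a topology \<Rightarrow> 'a set \<Rightarrow> bool" where
  "residual_in T A \<longleftrightarrow> A \<subseteq> topspace T \<and> meagre_in T (topspace T - A)"

end

theory Submission
  imports Defs
begin

text \<open>
  Two facts make the supremum \<open>s\<close> of the Assouad dimensions generic.

  The dimension can be prescribed by the tail of the sequence: \<open>F\<^sub>v\<^sub>u\<close> contains a bi-Lipschitz
  copy of \<open>F\<^sub>u\<close> for every finite word \<open>v\<close>, so \<open>dim F\<^sub>v\<^sub>u \<ge> dim F\<^sub>u\<close>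
  (\<open>admissible_exponent_prepend_prefix\<close>). Hence for each \<open>\<alpha> < s\<close> the sequences whose attractor
  has dimension greater than \<open>\<alpha>\<close> are dense.

  A failure of the Assouad estimate at one pair of scales is stable: it involves only two fixed
  positive radii, and \<open>F\<^sub>\<omega>\<close> depends continuously on \<open>\<omega>\<close> in the sense that every point of
  \<open>F\<^sub>u\<close> lies close to \<open>F\<^sub>\<omega>\<close> once \<open>u\<close> and \<open>\<omega>\<close> share a long prefix
  (\<open>attractor_point_near\<close>). So if \<open>F\<^sub>u\<close> violates the estimate at \<open>(r, R)\<close>, then on a whole
  cylinder around \<open>u\<close> the sets \<open>F\<^sub>\<omega>\<close> violate it at \<open>(r/2, 2R)\<close>, with a smaller constant
  (\<open>assouad_estimate_violation_stable\<close>).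

  Together, for fixed \<open>C\<close>, \<open>\<rho>\<close> and \<open>\<alpha> < s\<close>, the sequences whose attractor obeys the Assouad
  estimate form a nowhere dense set, and countably many such sets cover
  \<open>{\<omega>. dim F\<^sub>\<omega> < s}\<close>. Only lower bounds on covering numbers are ever
  transported, and for these a map into the larger set suffices.
\<close>

section \<open>Covering numbers and the Assouad estimate\<close>

text \<open>
  Pull a cover of \<open>E'\<close> back along \<open>f\<close>. The hypothesis on \<open>f\<close> concerns only the two scales \<open>r\<close> and
  \<open>r'\<close>, so this serves both for bi-Lipschitz maps and for arbitrary choices of nearby points.
\<close>

lemma covering_number_le_of_map:
  assumes "f ` E \<subseteq> E'" and "0 \<le> r"
    and close: "\<And>x y. x \<in> E \<Longrightarrow> y \<in> E \<Longrightarrow> dist (f x) (f y) \<le> r' \<Longrightarrow> dist x y \<le> r"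
  shows "covering_number r E \<le> covering_number r' E'"
  unfolding covering_number_def[of r' E']
proof (rule INF_greatest)
  fix \<U> assume "\<U> \<in> {\<U>. finite \<U> \<and> E' \<subseteq> \<Union>\<U> \<and> (\<forall>U\<in>\<U>. bounded U \<and> diameter U \<le> r')}"
  then have U: "finite \<U>" "E' \<subseteq> \<Union>\<U>" "\<And>U. U \<in> \<U> \<Longrightarrow> bounded U \<and> diameter U \<le> r'"
    by auto
  define \<V> where "\<V> = (\<lambda>U. {x\<in>E. f x \<in> U}) ` \<U>"
  have pair: "dist x y \<le> r" if "V \<in> \<V>" "x \<in> V" "y \<in> V" for V x y
  proof -
    obtain U' where "U' \<in> \<U>" "f x \<in> U'" "f y \<in> U'" "x \<in> E" "y \<in> E"
      using \<open>V \<in> \<V>\<close> \<open>x \<in> V\<close> \<open>y \<in> V\<close> by (auto simp: \<V>_def)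
    moreover have "dist (f x) (f y) \<le> r'"
      using U(3)[OF \<open>U' \<in> \<U>\<close>] diameter_bounded_bound[of U' "f x" "f y"] calculation by force
    ultimately show ?thesis using close by blast
  qed
  have "bounded V \<and> diameter V \<le> r" if "V \<in> \<V>" for V
  proof
    show "bounded V"
      using pair[OF that] unfolding bounded_two_points by blast
    show "diameter V \<le> r"
      unfolding diameter_def using pair[OF that] \<open>0 \<le> r\<close> by (auto intro!: cSUP_least)
  qed
  moreover have "finite \<V>" "E \<subseteq> \<Union>\<V>"
    using U(1,2) \<open>f ` E \<subseteq> E'\<close> by (auto simp: \<V>_def)
  ultimately have "covering_number r E \<le> enat (card \<V>)"
    unfolding covering_number_def by (intro INF_lower) auto
  also have "\<dots> \<le> enat (card \<U>)"
    using U(1) by (simp add: \<V>_def card_image_le)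
  finally show "covering_number r E \<le> enat (card \<U>)" .
qed

lemma covering_number_ball_le_of_map:
  assumes "f ` F \<subseteq> F'" and "x \<in> F" and "0 \<le> r"
    and "\<And>y. y \<in> F \<Longrightarrow> dist x y < R \<Longrightarrow> dist (f x) (f y) < R'"
    and "\<And>y z. y \<in> F \<Longrightarrow> z \<in> F \<Longrightarrow> dist (f y) (f z) \<le> r' \<Longrightarrow> dist y z \<le> r"
  shows "covering_number r (ball x R \<inter> F) \<le> covering_number r' (ball (f x) R' \<inter> F')"
proof (rule covering_number_le_of_map[where f = f])
  show "f ` (ball x R \<inter> F) \<subseteq> ball (f x) R' \<inter> F'"
    using assms(1,4) by auto
  show "dist y z \<le> r" if "y \<in> ball x R \<inter> F" "z \<in> ball x R \<inter> F" "dist (f y) (f z) \<le> r'" for y z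
    using assms(5) that by blast
qed fact

definition assouad_estimate :: "real \<Rightarrow> real \<Rightarrow> real \<Rightarrow> 'a::metric_space set \<Rightarrow> bool" where
  "assouad_estimate C \<rho> \<alpha> F \<longleftrightarrow> (\<forall>r R. 0 < r \<and> r < R \<and> R \<le> \<rho> \<longrightarrow>
     (\<forall>x\<in>F. ereal_of_enat (covering_number r (ball x R \<inter> F)) \<le> ereal (C * (R / r) powr \<alpha>)))"

definition admissible_exponent :: "real \<Rightarrow> 'a::metric_space set \<Rightarrow> bool" where
  "admissible_exponent \<alpha> F \<longleftrightarrow> (\<exists>C>0. \<exists>\<rho>>0. assouad_estimate C \<rho> \<alpha> F)"

lemma assouad_dim_eq_Inf_admissible:
  "assouad_dim F = Inf {ereal \<alpha> | \<alpha>. 0 \<le> \<alpha> \<and> admissible_exponent \<alpha> F}"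
  unfolding assouad_dim_def admissible_exponent_def assouad_estimate_def SUP_le_iff ..

lemma not_admissible_below_assouad_dim:
  assumes "0 \<le> \<alpha>" and "ereal \<alpha> < assouad_dim F"
  shows "\<not> admissible_exponent \<alpha> F"
proof
  assume "admissible_exponent \<alpha> F"
  then have "assouad_dim F \<le> ereal \<alpha>"
    unfolding assouad_dim_eq_Inf_admissible using \<open>0 \<le> \<alpha>\<close> by (intro Inf_lower) auto
  then show False using assms(2) by simp
qed

lemma assouad_estimate_mono:
  assumes "assouad_estimate C \<rho> \<alpha> F" and "C \<le> C'" and "\<rho>' \<le> \<rho>" and "\<alpha> \<le> \<alpha>'" and "0 \<le> C'"
  shows "assouad_estimate C' \<rho>' \<alpha>' F"
  unfolding assouad_estimate_def
proof (intro allI impI ballI)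
  fix r R x assume rR: "0 < r \<and> r < R \<and> R \<le> \<rho>'" and "x \<in> F"
  have "ereal_of_enat (covering_number r (ball x R \<inter> F)) \<le> ereal (C * (R / r) powr \<alpha>)"
    using assms(1,3) rR \<open>x \<in> F\<close> unfolding assouad_estimate_def by auto
  also have "C * (R / r) powr \<alpha> \<le> C' * (R / r) powr \<alpha>'"
    using rR assms by (intro mult_mono powr_mono) auto
  finally show "ereal_of_enat (covering_number r (ball x R \<inter> F)) \<le> ereal (C' * (R / r) powr \<alpha>')"
    by simp
qed

text \<open>
  Monotonicity in all three parameters lets the witnesses of \<open>dim F < s\<close> be moved into a countable
  parameter set, which is what a meagre set demands.
\<close>

lemma assouad_dim_less_imp_countable_witness:
  assumes "assouad_dim F < s"
  shows "\<exists>(q::rat) (c::nat) (n::nat). 0 \<le> real_of_rat q \<and> ereal (real_of_rat q) < s \<and>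
    assouad_estimate (real (Suc c)) (inverse (real (Suc n))) (real_of_rat q) F"
proof -
  obtain \<alpha> where \<alpha>: "0 \<le> \<alpha>" "admissible_exponent \<alpha> F" "ereal \<alpha> < s"
    using assms unfolding assouad_dim_eq_Inf_admissible Inf_less_iff by auto
  then obtain C \<rho> where C: "C > 0" "\<rho> > 0" "assouad_estimate C \<rho> \<alpha> F"
    unfolding admissible_exponent_def by auto
  obtain \<beta> where \<beta>: "ereal \<alpha> < ereal \<beta>" "ereal \<beta> < s"
    using ereal_dense2[OF \<alpha>(3)] by auto
  obtain q where q: "\<alpha> < real_of_rat q" "real_of_rat q < \<beta>"
    using of_rat_dense[of \<alpha> \<beta>] \<beta>(1) by auto
  obtain c where "C \<le> real c"
    using real_arch_simple by blast
  then have c: "C \<le> real (Suc c)" by simp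
  obtain n where n: "inverse (real (Suc n)) < \<rho>"
    using reals_Archimedean[OF C(2)] by auto
  have "ereal (real_of_rat q) < s"
    using q(2) \<beta>(2) by (metis less_ereal.simps(1) less_trans)
  moreover have "assouad_estimate (real (Suc c)) (inverse (real (Suc n))) (real_of_rat q) F"
    using assouad_estimate_mono[OF C(3) c _ _] n q(1) by simp
  moreover have "0 \<le> real_of_rat q" using q(1) \<alpha>(1) by linarith
  ultimately show ?thesis by blast
qed

text \<open>
  A bi-Lipschitz map \<open>f\<close> with constants \<open>a \<le> b\<close> sends the scales \<open>(r, R)\<close> to \<open>(a r, b R)\<close>, whose
  ratio differs from \<open>R / r\<close> by the fixed factor \<open>b / a\<close>; this goes into the constant.
\<close>

lemma admissible_exponent_bilipschitz_preimage:
  assumes "bilipschitz_on F f" and "f ` F \<subseteq> F'" and "admissible_exponent \<alpha> F'"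
  shows "admissible_exponent \<alpha> F"
proof -
  obtain a b0 where ab0: "a > 0" "\<And>x y. x \<in> F \<Longrightarrow> y \<in> F \<Longrightarrow> a * dist x y \<le> dist (f x) (f y)"
      "\<And>x y. x \<in> F \<Longrightarrow> y \<in> F \<Longrightarrow> dist (f x) (f y) \<le> b0 * dist x y"
    using assms(1) unfolding bilipschitz_on_def by auto
  \<comment> \<open>On a singleton the given constants may satisfy \<open>b0 < a\<close>.\<close>
  define b where "b = max a b0"
  have ab: "0 < b" "a \<le> b" using ab0(1) by (auto simp: b_def)
  have upper: "dist (f x) (f y) \<le> b * dist x y" if "x \<in> F" "y \<in> F" for x y
    using ab0(3)[OF that] mult_right_mono[of b0 b "dist x y"] by (simp add: b_def)
  obtain C \<rho> where C: "C > 0" "\<rho> > 0" "assouad_estimate C \<rho> \<alpha> F'"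
    using assms(3) unfolding admissible_exponent_def by auto
  have "assouad_estimate (C * (b / a) powr \<alpha>) (\<rho> / b) \<alpha> F"
    unfolding assouad_estimate_def
  proof (intro allI impI ballI)
    fix r R x assume rR: "0 < r \<and> r < R \<and> R \<le> \<rho> / b" and "x \<in> F"
    have scales: "0 < a * r" "b * R \<le> \<rho>"
      using rR ab ab0(1) by (auto simp: field_simps)
    have "a * r < b * R"
      using rR ab ab0(1) by (intro mult_le_less_imp_less) auto
    note scales = scales this
    have "covering_number r (ball x R \<inter> F) \<le> covering_number (a * r) (ball (f x) (b * R) \<inter> F')"
    proof (rule covering_number_ball_le_of_map[OF assms(2) \<open>x \<in> F\<close>])
      show "dist (f x) (f y) < b * R" if "y \<in> F" "dist x y < R" for y
        using upper[OF \<open>x \<in> F\<close> \<open>y \<in> F\<close>] mult_strict_left_mono[OF \<open>dist x y < R\<close> \<open>0 < b\<close>] by simp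
      show "dist y z \<le> r" if "y \<in> F" "z \<in> F" "dist (f y) (f z) \<le> a * r" for y z
        using ab0(2)[OF \<open>y \<in> F\<close> \<open>z \<in> F\<close>] that(3) \<open>a > 0\<close> by (meson mult_le_cancel_left_pos order_trans)
    qed (use rR in auto)
    then have "ereal_of_enat (covering_number r (ball x R \<inter> F))
        \<le> ereal_of_enat (covering_number (a * r) (ball (f x) (b * R) \<inter> F'))"
      by simp
    also have "\<dots> \<le> ereal (C * ((b * R) / (a * r)) powr \<alpha>)"
    proof -
      have "f x \<in> F'" using assms(2) \<open>x \<in> F\<close> by blast
      then show ?thesis using C(3) scales unfolding assouad_estimate_def by blast
    qed
    also have "((b * R) / (a * r)) powr \<alpha> = (b / a * (R / r)) powr \<alpha>"
      by simp
    also have "\<dots> = (b / a) powr \<alpha> * (R / r) powr \<alpha>"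
      by (rule powr_mult)
    also have "C * ((b / a) powr \<alpha> * (R / r) powr \<alpha>) = C * (b / a) powr \<alpha> * (R / r) powr \<alpha>"
      by simp
    finally show "ereal_of_enat (covering_number r (ball x R \<inter> F))
        \<le> ereal (C * (b / a) powr \<alpha> * (R / r) powr \<alpha>)" .
  qed
  moreover have "0 < C * (b / a) powr \<alpha>" "0 < \<rho> / b"
    using C ab ab0(1) by auto
  ultimately show ?thesis unfolding admissible_exponent_def by blast
qed

section \<open>Attractors of random iterated function systems\<close>

lemma word_map_cong:
  "(\<And>n. n < k \<Longrightarrow> \<omega> n = \<omega>' n) \<Longrightarrow> (\<And>n. n < k \<Longrightarrow> i n = i' n) \<Longrightarrow>
    word_map S \<omega> i k = word_map S \<omega>' i' k"
  by (induction k) auto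

lemma word_map_case_nat:
  "word_map S (case_nat a u) (case_nat j i) (Suc k) = S a j \<circ> word_map S u i k"
proof (induction k)
  case (Suc k)
  have "word_map S (case_nat a u) (case_nat j i) (Suc (Suc k))
      = word_map S (case_nat a u) (case_nat j i) (Suc k) \<circ> S (u k) (i k)"
    by simp
  then show ?case unfolding Suc.IH by (simp add: comp_assoc)
qed simp

text \<open>The finiteness of the system gives one ratio \<open>c < 1\<close> that serves for all of its maps.\<close>

lemma bilipschitz_rifs_uniform_ratio:
  assumes "bilipschitz_rifs X N I S"
  obtains c where "0 \<le> c" "c < 1"
    "\<And>i j. i \<in> {1..N} \<Longrightarrow> j \<in> I i \<Longrightarrow> c-lipschitz_on X (S i j)"
proof -
  define P where "P = (SIGMA i:{1..N}. I i)"
  have "finite P" using assms by (auto simp: P_def bilipschitz_rifs_def)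
  have "\<forall>p\<in>P. \<exists>c<1. c-lipschitz_on X (S (fst p) (snd p))"
    using assms by (auto simp: P_def bilipschitz_rifs_def contraction_on_def)
  then obtain g where g: "\<And>p. p \<in> P \<Longrightarrow> g p < 1 \<and> (g p)-lipschitz_on X (S (fst p) (snd p))"
    by metis
  define c where "c = Max (insert 0 (g ` P))"
  have "0 \<le> c" "c < 1" using \<open>finite P\<close> g by (auto simp: c_def)
  moreover have "c-lipschitz_on X (S i j)" if "i \<in> {1..N}" "j \<in> I i" for i j
  proof -
    have p: "(i, j) \<in> P" using that by (auto simp: P_def)
    then have "g (i, j) \<le> c" using \<open>finite P\<close> by (auto simp: c_def)
    then show ?thesis using g[OF p] by (auto intro: lipschitz_on_le)
  qed
  ultimately show thesis using that by blast
qed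

lemma word_map_into:
  assumes "bilipschitz_rifs X N I S" and "\<omega> \<in> seq_space N" and "\<And>n. n < k \<Longrightarrow> i n \<in> I (\<omega> n)"
  shows "word_map S \<omega> i k ` X \<subseteq> X"
  using assms(3)
proof (induction k)
  case (Suc k)
  have "\<omega> k \<in> {1..N}" using assms(2) by (auto simp: seq_space_def)
  then have "S (\<omega> k) (i k) ` X \<subseteq> X"
    using assms(1) Suc.prems[of k] by (simp add: bilipschitz_rifs_def contraction_on_def)
  then show ?case using Suc.IH Suc.prems by (fastforce simp: image_comp[symmetric])
qed simp

lemma word_map_lipschitz:
  assumes rifs: "bilipschitz_rifs X N I S" and \<omega>: "\<omega> \<in> seq_space N"
    and i: "\<And>n. n < k \<Longrightarrow> i n \<in> I (\<omega> n)" and "0 \<le> c"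
    and c: "\<And>i j. i \<in> {1..N} \<Longrightarrow> j \<in> I i \<Longrightarrow> c-lipschitz_on X (S i j)"
  shows "(c ^ k)-lipschitz_on X (word_map S \<omega> i k)"
  using i
proof (induction k)
  case 0
  then show ?case by (auto intro: lipschitz_onI simp: id_def)
next
  case (Suc k)
  have "\<omega> k \<in> {1..N}" using \<omega> by (auto simp: seq_space_def)
  then have *: "c-lipschitz_on X (S (\<omega> k) (i k))" "S (\<omega> k) (i k) ` X \<subseteq> X"
    using c rifs Suc.prems[of k] by (auto simp: bilipschitz_rifs_def contraction_on_def)
  have "(c ^ k)-lipschitz_on X (word_map S \<omega> i k)" using Suc by simp
  then have "(c ^ k)-lipschitz_on (S (\<omega> k) (i k) ` X) (word_map S \<omega> i k)"
    using *(2) lipschitz_on_subset by blast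
  from lipschitz_on_compose[OF *(1) this] show ?case by (simp add: mult.commute)
qed

lemma attractor_subset:
  assumes "bilipschitz_rifs X N I S" and "\<omega> \<in> seq_space N"
  shows "attractor X I S \<omega> \<subseteq> X"
proof
  fix x assume "x \<in> attractor X I S \<omega>"
  then obtain i where "\<forall>n<1. i n \<in> I (\<omega> n)" "x \<in> word_map S \<omega> i 1 ` X"
    unfolding attractor_def by blast
  then show "x \<in> X" using word_map_into[OF assms, of 1 i] by blast
qed

lemma image_attractor_subset:
  assumes rifs: "bilipschitz_rifs X N I S" and u: "u \<in> seq_space N" and "j \<in> I a"
  shows "S a j ` attractor X I S u \<subseteq> attractor X I S (case_nat a u)"
proof
  fix y assume "y \<in> S a j ` attractor X I S u"
  then obtain x where x: "x \<in> attractor X I S u" "y = S a j x" by auto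
  show "y \<in> attractor X I S (case_nat a u)"
    unfolding attractor_def
  proof
    fix k :: nat assume "k \<in> {1..}"
    then obtain l where l: "k = Suc l" by (cases k) auto
    have "\<exists>i. (\<forall>n<l. i n \<in> I (u n)) \<and> x \<in> word_map S u i l ` X"
    proof (cases "l = 0")
      case True
      then show ?thesis using x(1) attractor_subset[OF rifs u] by auto
    next
      case False
      then have "l \<in> {1..}" by simp
      then show ?thesis using x(1) unfolding attractor_def by blast
    qed
    then obtain i z where i: "\<forall>n<l. i n \<in> I (u n)" "z \<in> X" "x = word_map S u i l z" by auto
    have "y = word_map S (case_nat a u) (case_nat j i) k z"
      unfolding l word_map_case_nat using i(3) x(2) by simp
    moreover have "\<forall>n<k. case_nat j i n \<in> I (case_nat a u n)"
      using i(1) \<open>j \<in> I a\<close> by (auto simp: l split: nat.split)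
    ultimately show "y \<in> (\<Union>i\<in>{i. \<forall>n<k. i n \<in> I (case_nat a u n)}.
        word_map S (case_nat a u) i k ` X)"
      using i(2) by blast
  qed
qed

lemma case_nat_in_seq_space: "a \<in> {1..N} \<Longrightarrow> u \<in> seq_space N \<Longrightarrow> case_nat a u \<in> seq_space N"
  by (auto simp: seq_space_def split: nat.split)

lemma admissible_exponent_prepend_letter:
  assumes rifs: "bilipschitz_rifs X N I S" and "a \<in> {1..N}" and u: "u \<in> seq_space N"
    and "admissible_exponent \<alpha> (attractor X I S (case_nat a u))"
  shows "admissible_exponent \<alpha> (attractor X I S u)"
proof -
  obtain j where j: "j \<in> I a" "bilipschitz_on X (S a j)"
    using rifs \<open>a \<in> {1..N}\<close> unfolding bilipschitz_rifs_def by blast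
  have "bilipschitz_on (attractor X I S u) (S a j)"
    using j(2) attractor_subset[OF rifs u] unfolding bilipschitz_on_def by (meson subsetD)
  then show ?thesis
    by (rule admissible_exponent_bilipschitz_preimage[OF _ image_attractor_subset[OF rifs u j(1)] assms(4)])
qed

definition prefix_then :: "nat \<Rightarrow> (nat \<Rightarrow> 'b) \<Rightarrow> (nat \<Rightarrow> 'b) \<Rightarrow> nat \<Rightarrow> 'b" where
  "prefix_then m \<omega> u n = (if n < m then \<omega> n else u (n - m))"

lemma prefix_then_0 [simp]: "prefix_then 0 \<omega> u = u"
  by (simp add: fun_eq_iff prefix_then_def)

lemma prefix_then_Suc: "prefix_then (Suc m) \<omega> u = case_nat (\<omega> 0) (prefix_then m (\<omega> \<circ> Suc) u)"
  by (simp add: fun_eq_iff prefix_then_def split: nat.split)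

lemma prefix_then_in_seq_space:
  "\<omega> \<in> seq_space N \<Longrightarrow> u \<in> seq_space N \<Longrightarrow> prefix_then m \<omega> u \<in> seq_space N"
  by (auto simp: prefix_then_def seq_space_def)

lemma admissible_exponent_prepend_prefix:
  assumes rifs: "bilipschitz_rifs X N I S" and "\<omega> \<in> seq_space N" and u: "u \<in> seq_space N"
    and "admissible_exponent \<alpha> (attractor X I S (prefix_then m \<omega> u))"
  shows "admissible_exponent \<alpha> (attractor X I S u)"
  using assms(2,4)
proof (induction m arbitrary: \<omega>)
  case (Suc m)
  have tail: "\<omega> \<circ> Suc \<in> seq_space N" and head: "\<omega> 0 \<in> {1..N}"
    using Suc.prems(1) by (auto simp: seq_space_def)
  have "admissible_exponent \<alpha> (attractor X I S (prefix_then m (\<omega> \<circ> Suc) u))"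
    by (rule admissible_exponent_prepend_letter[OF rifs head prefix_then_in_seq_space[OF tail u]])
      (use Suc.prems(2) in \<open>simp only: prefix_then_Suc\<close>)
  then show ?case by (rule Suc.IH[OF tail])
qed simp

text \<open>
  Continue the finite choice of maps arbitrarily: the images of \<open>X\<close> under the growing compositions
  form a decreasing sequence of non-empty compact sets, and any common point lies in the attractor.
\<close>

lemma attractor_meets_piece:
  assumes "compact X" and "X \<noteq> {}" and rifs: "bilipschitz_rifs X N I S"
    and \<omega>: "\<omega> \<in> seq_space N" and i: "\<And>n. n < k \<Longrightarrow> i n \<in> I (\<omega> n)"
  shows "\<exists>y. y \<in> attractor X I S \<omega> \<and> y \<in> word_map S \<omega> i k ` X"
proof -
  define i' where "i' n = (if n < k then i n else SOME j. j \<in> I (\<omega> n))" for n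
  have \<omega>n: "\<omega> n \<in> {1..N}" for n
    using \<omega> unfolding seq_space_def by blast
  have I_ne: "I (\<omega> n) \<noteq> {}" for n
    using rifs \<omega>n[of n] unfolding bilipschitz_rifs_def by blast
  have i': "i' n \<in> I (\<omega> n)" for n
    using i I_ne by (auto simp: i'_def some_in_eq)
  define K where "K n = word_map S \<omega> i' n ` X" for n
  obtain c where c: "0 \<le> c" "\<And>i j. i \<in> {1..N} \<Longrightarrow> j \<in> I i \<Longrightarrow> c-lipschitz_on X (S i j)"
    using bilipschitz_rifs_uniform_ratio[OF rifs] by metis
  have "closedin (top_of_set X) (K n)" for n
  proof (rule closed_subset)
    show "K n \<subseteq> X"
      unfolding K_def by (rule word_map_into[OF rifs \<omega> i'])
    have "continuous_on X (word_map S \<omega> i' n)"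
      by (rule lipschitz_on_continuous_on[OF word_map_lipschitz[OF rifs \<omega> i' c]])
    then show "closed (K n)"
      unfolding K_def using \<open>compact X\<close> by (intro compact_imp_closed compact_continuous_image)
  qed
  moreover have "K n \<noteq> {}" for n
    using \<open>X \<noteq> {}\<close> by (simp add: K_def)
  moreover have "K (Suc n) \<subseteq> K n" for n
  proof -
    have "S (\<omega> n) (i' n) ` X \<subseteq> X"
      using rifs \<omega>n[of n] i'[of n] by (simp add: bilipschitz_rifs_def contraction_on_def)
    then show ?thesis by (auto simp: K_def image_comp[symmetric])
  qed
  then have "decseq K" by (rule decseq_SucI)
  ultimately obtain y where y: "y \<in> (\<Inter>n. K n)"
    using compact_space_imp_nest[of "top_of_set X" K] \<open>compact X\<close>
    by (auto simp: compact_space_subtopology)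
  have "word_map S \<omega> i' k = word_map S \<omega> i k"
    by (rule word_map_cong) (auto simp: i'_def)
  then have "y \<in> word_map S \<omega> i k ` X"
    using INT_D[OF y, of k] by (simp add: K_def)
  moreover have "y \<in> attractor X I S \<omega>"
    unfolding attractor_def
  proof (rule INT_I)
    fix n
    have "y \<in> word_map S \<omega> i' n ` X" using y by (auto simp: K_def)
    then show "y \<in> (\<Union>i\<in>{i. \<forall>m<n. i m \<in> I (\<omega> m)}. word_map S \<omega> i n ` X)"
      using i' by (intro UN_I[of i']) auto
  qed
  ultimately show ?thesis by blast
qed

text \<open>
  Points in a common piece of level \<open>k\<close> are at distance at most \<open>c\<^sup>k diam X\<close>, and the pieces of level
  \<open>k\<close> depend only on the first \<open>k\<close> letters.
\<close>

lemma attractor_point_near: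
  assumes "compact X" and rifs: "bilipschitz_rifs X N I S" and "0 < \<epsilon>"
  obtains k where "\<And>u \<omega> x. u \<in> seq_space N \<Longrightarrow> \<omega> \<in> seq_space N \<Longrightarrow> (\<forall>n<k. u n = \<omega> n) \<Longrightarrow>
    x \<in> attractor X I S u \<Longrightarrow> \<exists>y\<in>attractor X I S \<omega>. dist x y \<le> \<epsilon>"
proof -
  obtain c where c: "0 \<le> c" "c < 1"
      "\<And>i j. i \<in> {1..N} \<Longrightarrow> j \<in> I i \<Longrightarrow> c-lipschitz_on X (S i j)"
    using bilipschitz_rifs_uniform_ratio[OF rifs] by metis
  define D where "D = diameter X"
  have bX: "bounded X" using \<open>compact X\<close> compact_imp_bounded by blast
  have "0 \<le> D" unfolding D_def using diameter_ge_0[OF bX] .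
  have "0 < \<epsilon> / (D + 1)" using \<open>0 \<le> D\<close> \<open>0 < \<epsilon>\<close> by simp
  then obtain k0 where k0: "c ^ k0 < \<epsilon> / (D + 1)"
    using real_arch_pow_inv[OF _ c(2)] by blast
  \<comment> \<open>The attractor is an intersection over levels \<open>k \<ge> 1\<close> only.\<close>
  define k where "k = Suc k0"
  have "c ^ k * D \<le> c ^ k0 * D"
    using c \<open>0 \<le> D\<close> by (intro mult_right_mono) (auto simp: k_def mult_left_le_one_le)
  also have "\<dots> \<le> c ^ k0 * (D + 1)"
    using c by (intro mult_left_mono) auto
  also have "\<dots> \<le> \<epsilon>" using k0 \<open>0 \<le> D\<close> by (simp add: field_simps)
  finally have small: "c ^ k * D \<le> \<epsilon>" .
  have "\<exists>y\<in>attractor X I S \<omega>. dist x y \<le> \<epsilon>"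
    if u: "u \<in> seq_space N" and \<omega>: "\<omega> \<in> seq_space N" and agree: "\<forall>n<k. u n = \<omega> n"
      and x: "x \<in> attractor X I S u" for u \<omega> x
  proof -
    have "k \<in> {1..}" by (simp add: k_def)
    then obtain i p where i: "\<And>n. n < k \<Longrightarrow> i n \<in> I (u n)" and p: "p \<in> X" "x = word_map S u i k p"
      using x unfolding attractor_def by blast
    have i\<omega>: "\<And>n. n < k \<Longrightarrow> i n \<in> I (\<omega> n)" using i agree by metis
    obtain y where y: "y \<in> attractor X I S \<omega>" "y \<in> word_map S \<omega> i k ` X"
      using attractor_meets_piece[OF \<open>compact X\<close> _ rifs \<omega>, of k i] i\<omega> p(1) by blast
    have "word_map S \<omega> i k = word_map S u i k"
      using agree by (intro word_map_cong) auto
    then obtain q where q: "q \<in> X" "y = word_map S u i k q" using y(2) by auto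
    have "dist x y \<le> c ^ k * dist p q"
      using lipschitz_onD[OF word_map_lipschitz[OF rifs u i c(1,3)] p(1) q(1)] p(2) q(2) by simp
    also have "\<dots> \<le> c ^ k * D"
      using diameter_bounded_bound[OF bX p(1) q(1)] c(1) by (auto simp: D_def intro: mult_left_mono)
    finally show ?thesis using y(1) small by force
  qed
  then show thesis using that by blast
qed

text \<open>
  Replacing each point of \<open>F\<^sub>u\<close> by a point of \<open>F\<^sub>\<omega>\<close> at distance at most \<open>r / 4\<close> changes distances
  by at most \<open>r / 2\<close>. Hence \<open>N\<^sub>r\<close> of an \<open>R\<close>-ball in \<open>F\<^sub>u\<close> is at most \<open>N\<^sub>r\<^sub>/\<^sub>2\<close> of a \<open>2R\<close>-ball in
  \<open>F\<^sub>\<omega>\<close>. The ratio of the two scales grows by a factor \<open>4\<close>, which is the origin of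
  \<open>4\<^sup>\<alpha>\<close> in the hypothesis.
\<close>

lemma assouad_estimate_violation_stable:
  assumes "compact X" and rifs: "bilipschitz_rifs X N I S" and u: "u \<in> seq_space N"
    and viol: "\<not> assouad_estimate (C * 4 powr \<alpha>) (\<rho> / 2) \<alpha> (attractor X I S u)"
  obtains k where "\<And>\<omega>. \<omega> \<in> seq_space N \<Longrightarrow> (\<forall>n<k. u n = \<omega> n) \<Longrightarrow>
    \<not> assouad_estimate C \<rho> \<alpha> (attractor X I S \<omega>)"
proof -
  let ?F = "attractor X I S"
  obtain r R x where rR: "0 < r" "r < R" "R \<le> \<rho> / 2" and x: "x \<in> ?F u"
    and big: "\<not> ereal_of_enat (covering_number r (ball x R \<inter> ?F u))
      \<le> ereal (C * 4 powr \<alpha> * (R / r) powr \<alpha>)"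
    using viol unfolding assouad_estimate_def by metis
  obtain k where k: "\<And>u \<omega> x. u \<in> seq_space N \<Longrightarrow> \<omega> \<in> seq_space N \<Longrightarrow> (\<forall>n<k. u n = \<omega> n) \<Longrightarrow>
      x \<in> ?F u \<Longrightarrow> \<exists>y\<in>?F \<omega>. dist x y \<le> r / 4"
    using attractor_point_near[OF \<open>compact X\<close> rifs, of "r / 4"] rR(1) by auto
  have "\<not> assouad_estimate C \<rho> \<alpha> (?F \<omega>)" if \<omega>: "\<omega> \<in> seq_space N" and agree: "\<forall>n<k. u n = \<omega> n" for \<omega>
  proof
    assume est: "assouad_estimate C \<rho> \<alpha> (?F \<omega>)"
    obtain f where f: "\<And>y. y \<in> ?F u \<Longrightarrow> f y \<in> ?F \<omega>" "\<And>y. y \<in> ?F u \<Longrightarrow> dist y (f y) \<le> r / 4"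
      using k[OF u \<omega> agree] by metis
    have near: "\<bar>dist (f y) (f z) - dist y z\<bar> \<le> r / 2" if "y \<in> ?F u" "z \<in> ?F u" for y z
      using f(2)[OF that(1)] f(2)[OF that(2)] by metric
    have "covering_number r (ball x R \<inter> ?F u) \<le> covering_number (r / 2) (ball (f x) (2 * R) \<inter> ?F \<omega>)"
    proof (rule covering_number_ball_le_of_map[OF _ x])
      show "dist (f x) (f y) < 2 * R" if "y \<in> ?F u" "dist x y < R" for y
        using near[OF x that(1)] that(2) rR by linarith
      show "dist y z \<le> r" if "y \<in> ?F u" "z \<in> ?F u" "dist (f y) (f z) \<le> r / 2" for y z
        using near[OF that(1,2)] that(3) by linarith
    qed (use f(1) rR in auto)
    then have "ereal_of_enat (covering_number r (ball x R \<inter> ?F u))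
        \<le> ereal_of_enat (covering_number (r / 2) (ball (f x) (2 * R) \<inter> ?F \<omega>))"
      by simp
    also have "\<dots> \<le> ereal (C * ((2 * R) / (r / 2)) powr \<alpha>)"
    proof -
      have "0 < r / 2 \<and> r / 2 < 2 * R \<and> 2 * R \<le> \<rho>" using rR by auto
      then show ?thesis using est f(1)[OF x] unfolding assouad_estimate_def by blast
    qed
    also have "C * ((2 * R) / (r / 2)) powr \<alpha> = C * (4 * (R / r)) powr \<alpha>"
      by simp
    also have "\<dots> = C * 4 powr \<alpha> * (R / r) powr \<alpha>"
      by (simp only: powr_mult mult.assoc)
    finally show False using big by blast
  qed
  then show thesis using that by blast
qed

section \<open>Category in the sequence space\<close>

lemma seq_dist_less_iff:
  "seq_dist x y < 2 powr - real k \<longleftrightarrow> (\<forall>n\<le>k. x n = y n)"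
proof (cases "x = y")
  case False
  then have "seq_dist x y < 2 powr - real k \<longleftrightarrow> Suc k \<le> common_prefix_length x y"
    by (auto simp: seq_dist_def)
  also have "\<dots> \<longleftrightarrow> (\<forall>n\<le>k. x n = y n)"
    using common_prefix_length_ge_iff[OF False, of "Suc k"] by (simp add: less_Suc_eq_le)
  finally show ?thesis .
qed (simp add: seq_dist_def)

lemma nowhere_dense_in_seq_topologyI:
  assumes "A \<subseteq> seq_space N"
    and avoid: "\<And>\<omega> m. \<omega> \<in> seq_space N \<Longrightarrow>
      \<exists>\<omega>'\<in>seq_space N. (\<forall>n<m. \<omega> n = \<omega>' n) \<and> (\<exists>k. \<forall>\<eta>\<in>A. \<exists>n<k. \<omega>' n \<noteq> \<eta> n)"
  shows "nowhere_dense_in (seq_topology N) A"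
proof -
  interpret M: Metric_space "seq_space N" seq_dist by (rule Metric_space_seq)
  let ?cl = "seq_topology N closure_of A"
  have "\<omega> \<notin> seq_topology N interior_of ?cl" for \<omega>
  proof
    assume "\<omega> \<in> seq_topology N interior_of ?cl"
    then obtain U where U: "openin (seq_topology N) U" "\<omega> \<in> U" "U \<subseteq> ?cl"
      unfolding interior_of_def by auto
    then obtain e where e: "e > 0" "M.mball \<omega> e \<subseteq> U" and \<omega>: "\<omega> \<in> seq_space N"
      unfolding M.openin_mtopology by blast
    obtain m where "(1 / 2) ^ m < e"
      using real_arch_pow_inv[OF e(1), of "1 / 2"] by auto
    then have m: "2 powr - real m < e" by (simp add: powr_minus powr_realpow power_one_over inverse_eq_divide)
    obtain \<omega>' k where \<omega>': "\<omega>' \<in> seq_space N" "\<forall>n<Suc m. \<omega> n = \<omega>' n"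
      and k: "\<forall>\<eta>\<in>A. \<exists>n<k. \<omega>' n \<noteq> \<eta> n"
      using avoid[OF \<omega>, of "Suc m"] by blast
    have "seq_dist \<omega> \<omega>' < e"
      using m \<omega>'(2) seq_dist_less_iff[of \<omega> \<omega>' m] by (simp add: less_Suc_eq_le)
    then have "\<omega>' \<in> ?cl" using e(2) U(3) \<omega> \<omega>'(1) by auto
    then have "\<exists>\<eta>\<in>A. \<eta> \<in> M.mball \<omega>' (2 powr - real k)"
      unfolding M.metric_closure_of by simp
    then obtain \<eta> where "\<eta> \<in> A" "seq_dist \<omega>' \<eta> < 2 powr - real k" by auto
    then show False using k seq_dist_less_iff[of \<omega>' \<eta> k] by auto
  qed
  then show ?thesis using assms(1) unfolding nowhere_dense_in_def by auto
qed

lemma nowhere_dense_in_subset: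
  "nowhere_dense_in T A \<Longrightarrow> B \<subseteq> A \<Longrightarrow> nowhere_dense_in T B"
  using interior_of_mono[OF closure_of_mono, of B A T T] by (auto simp: nowhere_dense_in_def)

text \<open>
  Since \<open>\<alpha>\<close> is below the supremum, some \<open>F\<^sub>u\<close> has dimension greater than \<open>\<alpha>\<close>. Given any cylinder,
  append \<open>u\<close> to its defining word: the new attractor violates every Assouad estimate with exponent
  \<open>\<alpha>\<close>, and by stability a smaller cylinder misses the set altogether.
\<close>

lemma nowhere_dense_assouad_estimate:
  assumes "compact X" and rifs: "bilipschitz_rifs X N I S"
    and "0 \<le> \<alpha>" and "ereal \<alpha> < (SUP u\<in>seq_space N. assouad_dim (attractor X I S u))"
    and "0 < C" and "0 < \<rho>"
  shows "nowhere_dense_in (seq_topology N)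
    {\<omega>\<in>seq_space N. assouad_estimate C \<rho> \<alpha> (attractor X I S \<omega>)}"
proof (rule nowhere_dense_in_seq_topologyI)
  fix \<omega> m assume \<omega>: "\<omega> \<in> seq_space N"
  obtain u where u: "u \<in> seq_space N" "ereal \<alpha> < assouad_dim (attractor X I S u)"
    using assms(4) by (auto simp: less_SUP_iff)
  let ?v = "prefix_then m \<omega> u"
  have v: "?v \<in> seq_space N" by (rule prefix_then_in_seq_space[OF \<omega> u(1)])
  have "\<not> admissible_exponent \<alpha> (attractor X I S ?v)"
    using admissible_exponent_prepend_prefix[OF rifs \<omega> u(1)]
      not_admissible_below_assouad_dim[OF \<open>0 \<le> \<alpha>\<close> u(2)] by blast
  then have viol: "\<not> assouad_estimate (C * 4 powr \<alpha>) (\<rho> / 2) \<alpha> (attractor X I S ?v)"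
    using assms(5,6) unfolding admissible_exponent_def by auto
  obtain k where k: "\<And>\<eta>. \<eta> \<in> seq_space N \<Longrightarrow> (\<forall>n<k. ?v n = \<eta> n) \<Longrightarrow>
      \<not> assouad_estimate C \<rho> \<alpha> (attractor X I S \<eta>)"
    using assouad_estimate_violation_stable[OF \<open>compact X\<close> rifs v viol] by metis
  have prefix: "\<forall>n<m. \<omega> n = ?v n" by (simp add: prefix_then_def)
  have "\<forall>\<eta>\<in>{\<omega>\<in>seq_space N. assouad_estimate C \<rho> \<alpha> (attractor X I S \<omega>)}. \<exists>n<k. ?v n \<noteq> \<eta> n"
    using k by auto
  with v prefix show "\<exists>\<omega>'\<in>seq_space N. (\<forall>n<m. \<omega> n = \<omega>' n) \<and>
      (\<exists>k. \<forall>\<eta>\<in>{\<omega>\<in>seq_space N. assouad_estimate C \<rho> \<alpha> (attractor X I S \<omega>)}. \<exists>n<k. \<omega>' n \<noteq> \<eta> n)"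
    by (intro bexI[of _ ?v] conjI exI[of _ k])
qed auto

theorem theorem4p2:
  fixes X :: "'a::metric_space set"
    and N :: nat
    and I :: "nat \<Rightarrow> 'j set"
    and S :: "nat \<Rightarrow> 'j \<Rightarrow> 'a \<Rightarrow> 'a"
  assumes "compact X"
    and "bilipschitz_rifs X N I S"
  shows "\<exists>R. residual_in (seq_topology N) R \<and>
    (\<forall>\<omega>\<in>R. assouad_dim (attractor X I S \<omega>) =
       (SUP u\<in>seq_space N. assouad_dim (attractor X I S u)))"
proof -
  let ?dim = "\<lambda>\<omega>. assouad_dim (attractor X I S \<omega>)"
  define s where "s = (SUP u\<in>seq_space N. ?dim u)"
  define L where "L = {\<omega>\<in>seq_space N. ?dim \<omega> < s}"
  define P where "P = {(q::rat, c::nat, n::nat). 0 \<le> real_of_rat q \<and> ereal (real_of_rat q) < s}"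
  define A where "A = (\<lambda>(q::rat, c::nat, n::nat). {\<omega>\<in>seq_space N.
    assouad_estimate (real (Suc c)) (inverse (real (Suc n))) (real_of_rat q) (attractor X I S \<omega>)})"
  define R where "R = {\<omega>\<in>seq_space N. ?dim \<omega> = s}"
  have space: "topspace (seq_topology N) = seq_space N"
    by (rule Metric_space.topspace_mtopology[OF Metric_space_seq])
  have "?dim \<omega> \<le> s" if "\<omega> \<in> seq_space N" for \<omega>
    using that by (auto simp: s_def intro: SUP_upper)
  then have compl: "seq_space N - R = L"
    by (auto simp: R_def L_def less_le)
  have "L \<subseteq> (\<Union>p\<in>P. A p)"
  proof
    fix \<omega> assume "\<omega> \<in> L"
    then have "\<omega> \<in> seq_space N" "?dim \<omega> < s" by (auto simp: L_def)
    with assouad_dim_less_imp_countable_witness[OF this(2)] show "\<omega> \<in> (\<Union>p\<in>P. A p)"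
      by (fastforce simp: P_def A_def)
  qed
  then have union: "L = \<Union>((\<lambda>p. A p \<inter> L) ` P)" by auto
  have "nowhere_dense_in (seq_topology N) (A p)" if "p \<in> P" for p
    using that nowhere_dense_assouad_estimate[OF assms]
    by (auto simp: P_def A_def s_def simp del: of_nat_Suc)
  then have "nowhere_dense_in (seq_topology N) (A p \<inter> L)" if "p \<in> P" for p
    using that nowhere_dense_in_subset by blast
  moreover have "countable ((\<lambda>p. A p \<inter> L) ` P)" by simp
  ultimately have "meagre_in (seq_topology N) L"
    unfolding meagre_in_def using union by (intro exI[of _ "(\<lambda>p. A p \<inter> L) ` P"]) blast
  then have "residual_in (seq_topology N) R"
    unfolding residual_in_def space compl by (auto simp: R_def)
  then show ?thesis by (auto simp: R_def s_def)
qed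

end
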